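(* Let $R$ be an $s$-unital ring and let $\delta : R \to R$ be a derivation such that $\ker(\delta)$ contains a nonzero idempotent. Let $S := R[x;\delta]$ be the non-unital differential polynomial ring. Then the following five assertions are equivalent: (i) $S$ is a simple ring; (ii) $R$ is $\delta$-simple and $eSe$ is simple for every nonzero idempotent $e \in R$; (iii) $R$ is $\delta$-simple and $Z(eSe)$ is a field for every nonzero idempotent $e \in R$; (iv) $R$ is $\delta$-simple and $eSe$ is simple for some nonzero idempotent $e \in \ker(\delta)$; (v) $R$ is $\delta$-simple and $Z(eSe)$ is a field for some nonzero idempotent $e \in \ker(\delta)$.
   Context: All rings are associative but not necessarily unital or commutative. A ring $R$ is $s$-unital if $r \in Rr \cap rR$ for all $r \in R$. A derivation $\delta : R \to R$ is an additive map with $\delta(rs) = r\delta(s) + \delta(r)s$ for all $r,s\in R$. Non-unital differential polynomial ring: $R[x;\delta]$ is the set of formal polynomials $r_0 + \sum_{i=1}^n r_i x^i$ with $r_i \in R$ (coefficients on the left; $x^i$ is a placeholder and need not itself be an element), with coefficientwise addition and with the biadditive multiplication determined by $(a x^n)(b x^m) = \sum_{i=0}^n \binom{n}{i} a\,\delta^{n-i}(b)\, x^{i+m}$ for $a,b \in R$ and $n,m \geq 0$, where $r x^0$ means the constant $r \in R$. This is an associative ring containing $R$ as the subring of constants. A ring is simple if it is nonzero and its only two-sided ideals are $\{0\}$ and itself. An ideal $J$ of $R$ is $\delta$-invariant if $\delta(J) \subseteq J$; $R$ is $\delta$-simple if $\{0\}$ and $R$ are the only $\delta$-invariant two-sided ideals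 of $R$. For an idempotent $e\in R \subseteq S$, $eSe = \{ese : s \in S\}$ is the corner subring, a ring with identity $e$. $Z(A)$ denotes the center of a ring $A$. *)

theory Defs
  imports "HOL-Algebra.Ideal" "HOL-Computational_Algebra.Polynomial"
begin

text \<open>
  The ring \<open>R\<close> is the universe of a type of class \<open>ring\<close>, which is associative but neither
  unital nor commutative. The rings built from it are HOL-Algebra ring records. These contain a
  field for the identity; where no identity is available it is \<^const>\<open>undefined\<close>, and none of
  the notions applied to such records mentions it.
\<close>

definition s_unital :: "'a::ring itself \<Rightarrow> bool" where
  "s_unital _ \<longleftrightarrow> (\<forall>r::'a. r \<in> range (\<lambda>a. a * r) \<inter> range (\<lambda>a. r * a))"

definition derivation :: "('a::ring \<Rightarrow> 'a) \<Rightarrow> bool" where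
  "derivation \<delta> \<longleftrightarrow> additive \<delta> \<and> (\<forall>r s. \<delta> (r * s) = r * \<delta> s + \<delta> r * s)"

definition type_ring :: "'a::ring ring" where
  "type_ring = \<lparr>carrier = UNIV, monoid.mult = (*), one = undefined, zero = 0, add = (+)\<rparr>"

text \<open>
  The library's \<^const>\<open>ideal\<close> presupposes a unital ring; this is the same notion without that
  requirement.
\<close>

definition two_sided_ideal :: "'a set \<Rightarrow> ('a, 'b) ring_scheme \<Rightarrow> bool" where
  "two_sided_ideal J A \<longleftrightarrow> additive_subgroup J A \<and>
     (\<forall>a \<in> J. \<forall>x \<in> carrier A. x \<otimes>\<^bsub>A\<^esub> a \<in> J \<and> a \<otimes>\<^bsub>A\<^esub> x \<in> J)"

definition simple_ring :: "('a, 'b) ring_scheme \<Rightarrow> bool" where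
  "simple_ring A \<longleftrightarrow> carrier A \<noteq> {\<zero>\<^bsub>A\<^esub>} \<and>
     (\<forall>J. two_sided_ideal J A \<longrightarrow> J = {\<zero>\<^bsub>A\<^esub>} \<or> J = carrier A)"

definition derivation_simple :: "('a::ring \<Rightarrow> 'a) \<Rightarrow> bool" where
  "derivation_simple \<delta> \<longleftrightarrow>
     (\<forall>J. two_sided_ideal J type_ring \<and> \<delta> ` J \<subseteq> J \<longrightarrow> J = {0} \<or> J = UNIV)"

text \<open>
  Multiplication of differential polynomials, with coefficients on the left. The innermost sum
  is the \<open>n choose i\<close>-fold multiple, since the natural numbers need not embed into \<open>R\<close>.
\<close>

definition diff_poly_mult :: "('a::ring \<Rightarrow> 'a) \<Rightarrow> 'a poly \<Rightarrow> 'a poly \<Rightarrow> 'a poly" where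
  "diff_poly_mult \<delta> p q =
     (\<Sum>n\<le>degree p. \<Sum>m\<le>degree q. \<Sum>i\<le>n.
        monom (\<Sum>_<n choose i. coeff p n * (\<delta> ^^ (n - i)) (coeff q m)) (i + m))"

definition diff_poly_ring :: "('a::ring \<Rightarrow> 'a) \<Rightarrow> 'a poly ring" where
  "diff_poly_ring \<delta> =
     \<lparr>carrier = UNIV, monoid.mult = diff_poly_mult \<delta>, one = undefined, zero = 0, add = (+)\<rparr>"

definition corner :: "('a, 'b) ring_scheme \<Rightarrow> 'a \<Rightarrow> ('a, 'b) ring_scheme" where
  "corner A e = A\<lparr>carrier := {e \<otimes>\<^bsub>A\<^esub> s \<otimes>\<^bsub>A\<^esub> e |s. s \<in> carrier A}, one := e\<rparr>"

definition center :: "('a, 'b) ring_scheme \<Rightarrow> ('a, 'b) ring_scheme" where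
  "center A =
     A\<lparr>carrier := {z \<in> carrier A. \<forall>a \<in> carrier A. z \<otimes>\<^bsub>A\<^esub> a = a \<otimes>\<^bsub>A\<^esub> z}\<rparr>"

lemma diff_poly_mult_upto:
  assumes "additive \<delta>" "degree p \<le> N" "degree q \<le> M"
  shows "diff_poly_mult \<delta> p q =
     (\<Sum>n\<le>N. \<Sum>m\<le>M. \<Sum>i\<le>n.
        monom (\<Sum>_<n choose i. coeff p n * (\<delta> ^^ (n - i)) (coeff q m)) (i + m))"
proof -
  have d0: "(\<delta> ^^ k) 0 = 0" for k
    by (induction k) (simp_all add: additive.zero[OF assms(1)])
  have "(\<Sum>m\<le>degree q. \<Sum>i\<le>n.
          monom (\<Sum>_<n choose i. coeff p n * (\<delta> ^^ (n - i)) (coeff q m)) (i + m)) =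
        (\<Sum>m\<le>M. \<Sum>i\<le>n.
          monom (\<Sum>_<n choose i. coeff p n * (\<delta> ^^ (n - i)) (coeff q m)) (i + m))" for n
    by (rule sum.mono_neutral_left) (use assms in \<open>auto simp: coeff_eq_0 d0\<close>)
  then show ?thesis unfolding diff_poly_mult_def
    by simp (rule sum.mono_neutral_left, use assms in \<open>auto simp: coeff_eq_0\<close>)
qed

lemma diff_poly_mult_monom:
  assumes "additive \<delta>"
  shows "diff_poly_mult \<delta> (monom a n) (monom b m) =
     (\<Sum>i\<le>n. monom (\<Sum>_<n choose i. a * (\<delta> ^^ (n - i)) b) (i + m))"
proof -
  have d0: "(\<delta> ^^ k) 0 = 0" for k
    by (induction k) (simp_all add: additive.zero[OF assms])
  let ?f = "\<lambda>k l. \<Sum>i\<le>k. monom (\<Sum>_<k choose i.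
    coeff (monom a n) k * (\<delta> ^^ (k - i)) (coeff (monom b m) l)) (i + l)"
  have inner: "(\<Sum>l\<le>m. ?f k l) = ?f k m" for k
    by (subst sum.mono_neutral_right[where S = "{m}"]) (auto simp: d0)
  have "diff_poly_mult \<delta> (monom a n) (monom b m) = (\<Sum>k\<le>n. \<Sum>l\<le>m. ?f k l)"
    by (rule diff_poly_mult_upto) (auto simp: assms degree_monom_le)
  also have "\<dots> = (\<Sum>k\<le>n. ?f k m)"
    by (simp only: inner)
  also have "\<dots> = ?f n m"
    by (subst sum.mono_neutral_right[where S = "{n}"]) auto
  finally show ?thesis by simp
qed

lemma diff_poly_mult_add_left:
  assumes "additive \<delta>"
  shows "diff_poly_mult \<delta> (p + p') q = diff_poly_mult \<delta> p q + diff_poly_mult \<delta> p' q"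
proof -
  let ?N = "max (degree p) (degree p')"
  show ?thesis
    by (subst (1 2 3) diff_poly_mult_upto[OF assms, where N = ?N and M = "degree q"])
       (auto simp: degree_add_le distrib_right sum.distrib add_monom[symmetric])
qed

lemma diff_poly_mult_add_right:
  assumes "additive \<delta>"
  shows "diff_poly_mult \<delta> p (q + q') = diff_poly_mult \<delta> p q + diff_poly_mult \<delta> p q'"
proof -
  have d: "(\<delta> ^^ k) (x + y) = (\<delta> ^^ k) x + (\<delta> ^^ k) y" for k x y
    by (induction k) (simp_all add: additive.add[OF assms])
  let ?M = "max (degree q) (degree q')"
  show ?thesis
    by (subst (1 2 3) diff_poly_mult_upto[OF assms, where N = "degree p" and M = ?M])
       (auto simp: degree_add_le d distrib_left sum.distrib add_monom[symmetric])
qed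

end

theory Submission
  imports "HOL-Algebra.Subrings" "HOL-Computational_Algebra.Group_Closure" Defs
begin

text \<open>
  Simplicity passes from \<open>S\<close> to a corner \<open>eSe\<close> because \<open>J = e(SJS)e\<close> for every ideal \<open>J\<close> of \<open>eSe\<close>,
  and the center of a simple unital ring is a field. For the way back let \<open>\<delta> e = 0\<close>, so that
  \<open>ex \<in> eSe\<close> and \<open>(ex)f - f(ex)\<close> is \<open>\<delta>\<close> applied to the coefficients of \<open>f \<in> eSe\<close>. Let \<open>I\<close> be a nonzero
  ideal of \<open>S\<close>, let \<open>n\<close> be the least degree of its nonzero elements, and let \<open>L\<close> be the ideal of
  \<open>n\<close>-th coefficients of elements of \<open>I\<close> of degree at most \<open>n\<close>. The set \<open>eLe\<close> is nonzero and
  \<open>\<delta>\<close>-invariant, hence \<open>R = R(eLe)R \<subseteq> L\<close> by \<open>\<delta>\<close>-simplicity. So there is \<open>h \<in> I \<inter> eSe\<close> with leading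
  term \<open>ex\<^sup>n\<close>. Its commutators with \<open>eRe\<close> and with \<open>ex\<close> lie in \<open>I\<close> and have degree below \<open>n\<close>, so
  they vanish and \<open>h\<close> is central in \<open>eSe\<close>. If \<open>Z(eSe)\<close> is a field, then \<open>h\<close> is invertible, so
  \<open>e \<in> I\<close>, and \<open>I = S\<close> follows from \<open>R = ReR\<close>.
\<close>

section \<open>Two-sided ideals as ideals closed under differences\<close>

lemma additive_subgroup_iff_diff_closed:
  fixes A :: "('b::ab_group_add, 'c) ring_scheme"
  assumes "zero A = 0" and "add A = (+)" and "\<And>x. x \<in> carrier A \<Longrightarrow> - x \<in> carrier A"
  shows "additive_subgroup J A \<longleftrightarrow>
    J \<subseteq> carrier A \<and> 0 \<in> J \<and> (\<forall>x\<in>J. \<forall>y\<in>J. x - y \<in> J)"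
proof -
  \<comment> \<open>The inverse of a record is a definite description. Once it is unary minus,
    subgroups are recognised by differences, which is also the closure rule of
    \<open>group_closure\<close>.\<close>
  have inv: "inv\<^bsub>add_monoid A\<^esub> x = - x" if "x \<in> carrier A" for x
    unfolding m_inv_def using assms that
    by (intro the_equality) (auto simp: eq_neg_iff_add_eq_0 add.commute)
  show ?thesis
  proof
    assume "additive_subgroup J A"
    then interpret subgroup J "add_monoid A" by (simp add: additive_subgroup_def)
    have "- x \<in> J" if "x \<in> J" for x
      using m_inv_closed[OF that] mem_carrier[OF that] by (simp add: inv)
    moreover have "x + y \<in> J" if "x \<in> J" "y \<in> J" for x y
      using m_closed[OF that] by (simp add: assms)
    ultimately show "J \<subseteq> carrier A \<and> 0 \<in> J \<and> (\<forall>x\<in>J. \<forall>y\<in>J. x - y \<in> J)"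
      using subset one_closed assms by (metis diff_conv_add_uminus monoid.simps(2) partial_object.select_convs(1))
  next
    assume J: "J \<subseteq> carrier A \<and> 0 \<in> J \<and> (\<forall>x\<in>J. \<forall>y\<in>J. x - y \<in> J)"
    have m: "- x \<in> J" if "x \<in> J" for x
      using J that by (metis diff_0)
    have "x + y \<in> J" if "x \<in> J" "y \<in> J" for x y
      using J that m[of y] by (metis diff_minus_eq_add)
    with J m show "additive_subgroup J A"
      using inv by (intro additive_subgroup.intro subgroup.intro) (force simp: assms subset_iff)+
  qed
qed

lemma two_sided_ideal_type_ring_iff:
  "two_sided_ideal J type_ring \<longleftrightarrow>
    0 \<in> J \<and> (\<forall>x\<in>J. \<forall>y\<in>J. x - y \<in> J) \<and> (\<forall>a\<in>J. \<forall>x. x * a \<in> J \<and> a * x \<in> J)"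
  unfolding two_sided_ideal_def
  by (subst additive_subgroup_iff_diff_closed) (auto simp: type_ring_def)

lemma two_sided_ideal_diff_poly_ring_iff:
  "two_sided_ideal J (diff_poly_ring \<delta>) \<longleftrightarrow>
    0 \<in> J \<and> (\<forall>x\<in>J. \<forall>y\<in>J. x - y \<in> J) \<and>
    (\<forall>a\<in>J. \<forall>x. diff_poly_mult \<delta> x a \<in> J \<and> diff_poly_mult \<delta> a x \<in> J)"
  unfolding two_sided_ideal_def
  by (subst additive_subgroup_iff_diff_closed) (auto simp: diff_poly_ring_def)

section \<open>The center of a unital ring\<close>

lemma carrier_center:
  "carrier (center A) = {z \<in> carrier A. \<forall>a \<in> carrier A. z \<otimes>\<^bsub>A\<^esub> a = a \<otimes>\<^bsub>A\<^esub> z}"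
  by (simp add: center_def)

lemma (in ring) subcring_center: "subcring (carrier (center R)) R"
proof (rule subcringI)
  show "subring (carrier (center R)) R"
  proof (rule subringI)
    fix h assume h: "h \<in> carrier (center R)"
    then show "\<ominus> h \<in> carrier (center R)"
      by (auto simp: center_def l_minus r_minus)
  next
    fix h k assume "h \<in> carrier (center R)" "k \<in> carrier (center R)"
    then have hk: "h \<in> carrier R" "k \<in> carrier R"
      and comm: "\<And>a. a \<in> carrier R \<Longrightarrow> h \<otimes> a = a \<otimes> h" "\<And>a. a \<in> carrier R \<Longrightarrow> k \<otimes> a = a \<otimes> k"
      by (auto simp: center_def)
    have "h \<otimes> k \<otimes> a = a \<otimes> (h \<otimes> k)" if a: "a \<in> carrier R" for a
    proof -
      have "h \<otimes> k \<otimes> a = h \<otimes> (a \<otimes> k)" using hk a comm(2)[OF a] by (simp add: m_assoc)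
      also have "\<dots> = (a \<otimes> h) \<otimes> k" using hk a comm(1)[OF a] by (simp flip: m_assoc)
      finally show ?thesis using hk a by (simp add: m_assoc)
    qed
    with hk show "h \<otimes> k \<in> carrier (center R)" by (simp add: center_def)
    show "h \<oplus> k \<in> carrier (center R)"
      using hk comm by (simp add: center_def l_distr r_distr)
  qed (simp_all add: center_def subset_iff)
  show "h \<otimes> k = k \<otimes> h" if "h \<in> carrier (center R)" "k \<in> carrier (center R)" for h k
    using that unfolding carrier_center by blast
qed

lemma (in ring) cring_center: "cring (center R)"
proof -
  have "center R = R\<lparr>carrier := carrier (center R)\<rparr>" by (simp add: center_def)
  then show ?thesis
    using subcring_center subcring_iff[of "carrier (center R)"]
    by (metis subcring_def subringE(1))
qed

text \<open>For a nonzero central \<open>z\<close> the set \<open>zR\<close> is a two-sided ideal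
  containing \<open>z\<close>, so it contains the identity. The resulting inverse of
  \<open>z\<close> is again central.\<close>

lemma (in ring) field_center_if_simple:
  assumes "simple_ring R"
  shows "field (center R)"
proof -
  interpret C: cring "center R" by (rule cring_center)
  have nz: "carrier R \<noteq> {\<zero>}" and
    simple: "\<And>J. two_sided_ideal J R \<Longrightarrow> J = {\<zero>} \<or> J = carrier R"
    using assms by (auto simp: simple_ring_def)
  show ?thesis
  proof (rule C.cring_fieldI2)
    show "\<zero>\<^bsub>center R\<^esub> \<noteq> \<one>\<^bsub>center R\<^esub>"
      using nz carrier_one_zero by (auto simp: center_def)
  next
    fix z assume "z \<in> carrier (center R)" and "z \<noteq> \<zero>\<^bsub>center R\<^esub>"
    then have z: "z \<in> carrier R" "z \<noteq> \<zero>" and comm: "\<And>a. a \<in> carrier R \<Longrightarrow> z \<otimes> a = a \<otimes> z"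
      by (auto simp: center_def)
    let ?J = "{z \<otimes> a |a. a \<in> carrier R}"
    have "two_sided_ideal ?J R"
      unfolding two_sided_ideal_def
    proof (intro conjI ballI)
      show "additive_subgroup ?J R"
      proof (intro additive_subgroup.intro subgroup.intro)
        fix x y assume "x \<in> ?J" "y \<in> ?J"
        then obtain a b where "x = z \<otimes> a" "y = z \<otimes> b" "a \<in> carrier R" "b \<in> carrier R" by auto
        then show "x \<otimes>\<^bsub>add_monoid R\<^esub> y \<in> ?J"
          using z by (auto intro!: exI[of _ "a \<oplus> b"] simp: r_distr)
      next
        show "\<one>\<^bsub>add_monoid R\<^esub> \<in> ?J" using z by (auto intro!: exI[of _ \<zero>])
      next
        fix x assume "x \<in> ?J"
        then obtain a where "x = z \<otimes> a" "a \<in> carrier R" by auto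
        then show "inv\<^bsub>add_monoid R\<^esub> x \<in> ?J"
          using z by (auto intro!: exI[of _ "\<ominus> a"] simp: r_minus a_inv_def[symmetric])
      qed (use z in auto)
    next
      fix y x assume "y \<in> ?J" and x: "x \<in> carrier R"
      then obtain a where a: "y = z \<otimes> a" "a \<in> carrier R" by auto
      have "x \<otimes> y = z \<otimes> (x \<otimes> a)" using a x z comm[OF x] by (metis m_assoc)
      then show "x \<otimes> y \<in> ?J" using a x by auto
      have "y \<otimes> x = z \<otimes> (a \<otimes> x)" using a x z by (simp add: m_assoc)
      then show "y \<otimes> x \<in> ?J" using a x by auto
    qed
    moreover have "z \<in> ?J" using z by (auto intro!: exI[of _ \<one>])
    ultimately have "?J = carrier R" using simple z by blast
    then obtain w where w: "w \<in> carrier R" "\<one> = z \<otimes> w" using one_closed by blast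
    have "w \<otimes> a = a \<otimes> w" if a: "a \<in> carrier R" for a
    proof -
      \<comment> \<open>Insert the identity as \<open>z \<otimes> w\<close> on the right, then move
        \<open>z\<close> past \<open>a\<close> to cancel the \<open>w\<close> on the left.\<close>
      have "w \<otimes> a = w \<otimes> (a \<otimes> (z \<otimes> w))" using a w(1) by (simp flip: w(2))
      also have "\<dots> = (w \<otimes> z) \<otimes> a \<otimes> w" using a w(1) z comm[OF a] by (simp add: m_assoc)
      also have "\<dots> = a \<otimes> w" using w comm a by (metis l_one)
      finally show ?thesis .
    qed
    with w show "\<exists>b\<in>carrier (center R). z \<otimes>\<^bsub>center R\<^esub> b = \<one>\<^bsub>center R\<^esub>"
      by (auto simp: center_def)
  qed
qed

section \<open>Products of differential polynomials through left multiplication operators\<close>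

locale derivation_ring =
  fixes \<delta> :: "'a::ring \<Rightarrow> 'a"
  assumes derivation: "derivation \<delta>"
begin

abbreviation mult (infixl "\<star>" 70)
  where "p \<star> q \<equiv> diff_poly_mult \<delta> p q"

lemma additive: "additive \<delta>" and leibniz: "\<delta> (r * s) = r * \<delta> s + \<delta> r * s"
  using derivation by (auto simp: derivation_def)

lemmas deriv_zero [simp] = additive.zero[OF additive]
lemmas deriv_add = additive.add[OF additive]
lemmas deriv_diff = additive.diff[OF additive]

lemma deriv_sum_const: "\<delta> (\<Sum>_<(k::nat). a) = (\<Sum>_<k. \<delta> a)"
  by (induction k) (simp_all add: deriv_add)

lemmas mult_add_left = diff_poly_mult_add_left[OF additive]
lemmas mult_add_right = diff_poly_mult_add_right[OF additive]

lemma mult_zero_left [simp]: "0 \<star> q = 0"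
  using mult_add_left[of 0 0 q] by simp

lemma mult_zero_right [simp]: "p \<star> 0 = 0"
  using mult_add_right[of p 0 0] by simp

lemma mult_diff_left: "(p - p') \<star> q = p \<star> q - p' \<star> q"
  using mult_add_left[of "p - p'" p' q] by (simp add: algebra_simps)

lemma mult_diff_right: "p \<star> (q - q') = p \<star> q - p \<star> q'"
  using mult_add_right[of p "q - q'" q'] by (simp add: algebra_simps)

lemma mult_sum_left: "sum f A \<star> q = (\<Sum>i\<in>A. f i \<star> q)"
  by (induction A rule: infinite_finite_induct) (auto simp: mult_add_left)

text \<open>The product is biadditive, so identities between products need checking on monomials
  only. The zero polynomial is covered as \<open>monom 0 0\<close>.\<close>

lemma poly_monom_induct [case_names monom add]:
  fixes p :: "'a poly"
  assumes "\<And>a n. P (monom a n)" and "\<And>p q. P p \<Longrightarrow> P q \<Longrightarrow> P (p + q)"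
  shows "P p"
proof -
  have "P (\<Sum>i\<in>I. monom (coeff p i) i)" if "finite I" for I
    using that assms(1)[of 0 0] by (induction I) (auto intro: assms)
  then show ?thesis using poly_as_sum_of_monoms[of p] by (metis finite_atMost)
qed

definition scale :: "'a \<Rightarrow> 'a poly \<Rightarrow> 'a poly" where
  "scale a p = map_poly ((*) a) p"

text \<open>Left multiplication by the indeterminate, which need not be an element of the ring.\<close>

definition shift :: "'a poly \<Rightarrow> 'a poly" where
  "shift p = pCons 0 p + map_poly \<delta> p"

lemma coeff_scale [simp]: "coeff (scale a p) k = a * coeff p k"
  by (simp add: scale_def coeff_map_poly)

lemma coeff_map_deriv [simp]: "coeff (map_poly \<delta> p) k = \<delta> (coeff p k)"
  by (simp add: coeff_map_poly)

lemma scale_simps: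
  "scale a 0 = 0" "scale a (p + q) = scale a p + scale a q" "scale a (scale b p) = scale (a * b) p"
  "scale a (monom b m) = monom (a * b) m" "scale (a + b) p = scale a p + scale b p"
  "scale 0 p = 0"
  by (auto simp: poly_eq_iff algebra_simps)

lemma scale_pCons_zero: "scale a (pCons 0 p) = pCons 0 (scale a p)"
  by (auto simp: poly_eq_iff coeff_pCons split: nat.splits)

lemma shift_zero [simp]: "shift 0 = 0"
  by (simp add: shift_def)

lemma shift_add: "shift (p + q) = shift p + shift q"
  by (auto simp: shift_def poly_eq_iff deriv_add coeff_pCons split: nat.splits)

lemma shift_sum: "shift (sum f A) = (\<Sum>i\<in>A. shift (f i))"
  by (induction A rule: infinite_finite_induct) (auto simp: shift_add)

lemma shift_monom: "shift (monom b m) = monom b (Suc m) + monom (\<delta> b) m"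
  by (simp add: shift_def monom_Suc map_poly_monom)

lemma shift_scale: "shift (scale b r) = scale b (shift r) + scale (\<delta> b) r"
  by (auto simp: shift_def poly_eq_iff leibniz algebra_simps coeff_pCons split: nat.splits)

lemma shift_funpow_add: "(shift ^^ n) (p + q) = (shift ^^ n) p + (shift ^^ n) q"
  by (induction n) (auto simp: shift_add)

lemma sum_const_add: "(\<Sum>_<(k + l::nat). c) = (\<Sum>_<k. c) + (\<Sum>_<l. (c::'a))"
  by (induction l) (simp_all add: algebra_simps)

text \<open>The iterated Leibniz formula, by induction with Pascal's rule. Its right side is the
  inner sum in the definition of the product, without the left coefficient.\<close>

lemma shift_funpow_monom:
  "(shift ^^ n) (monom b m) = (\<Sum>i\<le>n. monom (\<Sum>_<n choose i. (\<delta> ^^ (n - i)) b) (i + m))"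
proof (induction n)
  case 0
  show ?case by simp
next
  case (Suc n)
  let ?t = "\<lambda>(k::nat) i. monom (\<Sum>_<k. (\<delta> ^^ (Suc n - i)) b) (i + m)"
  have t_add: "?t (k + l) i = ?t k i + ?t l i" for k l i
    by (simp add: sum_const_add add_monom)
  have "(shift ^^ Suc n) (monom b m) =
      (\<Sum>i\<le>n. ?t (n choose i) (Suc i)) + (\<Sum>i\<le>n. ?t (n choose i) i)"
    by (auto simp: Suc shift_sum shift_monom sum.distrib deriv_sum_const Suc_diff_le
        intro!: sum.cong)
  \<comment> \<open>The added term carries the coefficient \<open>n choose Suc n\<close>, which is
    0. Splitting off index 0 then aligns both sums for Pascal's rule.\<close>
  also have "(\<Sum>i\<le>n. ?t (n choose i) i) = (\<Sum>i\<le>Suc n. ?t (n choose i) i)"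
    by (simp add: binomial_eq_0)
  also have "\<dots> = ?t 1 0 + (\<Sum>i\<le>n. ?t (n choose Suc i) (Suc i))"
    by (subst sum.atMost_Suc_shift) simp
  finally have "(shift ^^ Suc n) (monom b m) =
      ?t 1 0 + (\<Sum>i\<le>n. ?t ((n choose i) + (n choose Suc i)) (Suc i))"
    unfolding t_add sum.distrib by (simp only: ac_simps)
  also have "\<dots> = (\<Sum>i\<le>Suc n. ?t (Suc n choose i) i)"
    by (subst sum.atMost_Suc_shift) simp
  finally show ?case .
qed

lemma scale_sum: "scale a (sum f A) = (\<Sum>i\<in>A. scale a (f i))"
  by (induction A rule: infinite_finite_induct) (auto simp: scale_simps)

text \<open>This factors left multiplication by a monomial into the operators \<open>scale\<close>
  and \<open>shift\<close>, so later facts about products no longer touch the binomial sums.\<close>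

lemma monom_mult: "monom a n \<star> q = scale a ((shift ^^ n) q)"
proof (induction q rule: poly_monom_induct)
  case (monom b m)
  show ?case
    by (simp add: diff_poly_mult_monom[OF additive] shift_funpow_monom scale_sum scale_simps
        sum_distrib_left)
qed (simp add: mult_add_right shift_funpow_add scale_simps)

lemma const_mult: "[:a:] \<star> q = scale a q"
  using monom_mult[of a 0 q] by (simp add: monom_0)

lemma const_idempotent: "e * e = e \<Longrightarrow> [:e:] \<star> [:e:] = [:e:]"
  using scale_simps(4)[of e e 0] by (simp add: const_mult monom_0)

lemma scale_mult: "scale a p \<star> q = scale a (p \<star> q)"
  by (induction p rule: poly_monom_induct)
    (simp_all add: mult_add_left scale_simps monom_mult)

text \<open>For \<open>p = monom b m\<close> this is \<open>shift_scale\<close> applied to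
  \<open>(shift ^^ m) q\<close>.\<close>

lemma shift_mult: "shift p \<star> q = shift (p \<star> q)"
  by (induction p rule: poly_monom_induct)
    (simp_all add: mult_add_left shift_add shift_monom monom_mult shift_scale)

lemma shift_funpow_mult: "(shift ^^ n) p \<star> q = (shift ^^ n) (p \<star> q)"
  by (induction n) (simp_all add: shift_mult)

text \<open>For a monomial \<open>p\<close>, associativity says that \<open>scale\<close> and
  \<open>shift\<close> commute with right multiplication by \<open>r\<close>.\<close>

lemma mult_assoc: "(p \<star> q) \<star> r = p \<star> (q \<star> r)"
  by (induction p rule: poly_monom_induct)
    (simp_all add: mult_add_left monom_mult scale_mult shift_funpow_mult)

lemma mult_eq_sum:
  assumes "degree p \<le> n"
  shows "p \<star> q = (\<Sum>k\<le>n. scale (coeff p k) ((shift ^^ k) q))"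
  using arg_cong[OF poly_as_sum_of_monoms'[OF assms], of "\<lambda>p. p \<star> q"]
  by (simp add: mult_sum_left monom_mult)

section \<open>Top coefficients, and constants of the derivation\<close>

lemma coeff_shift_funpow_const:
  "k < j \<Longrightarrow> coeff ((shift ^^ k) [:b:]) j = 0" "coeff ((shift ^^ k) [:b:]) k = b"
proof (induction k arbitrary: j)
  case (Suc k)
  { case 1
    then show ?case using Suc.IH(1) by (cases j) (auto simp: shift_def) }
  { case 2
    then show ?case using Suc.IH by (auto simp: shift_def) }
qed (auto simp: coeff_pCons split: nat.splits)

text \<open>Moving \<open>x^k\<close> past \<open>b\<close> yields \<open>b x^k\<close> plus lower
  powers, so only the term of \<open>p\<close> of degree \<open>n\<close> reaches the coefficient at
  \<open>n\<close>.\<close>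

lemma mult_const_degree_le:
  assumes "degree p \<le> n"
  shows "degree (p \<star> [:b:]) \<le> n" "coeff (p \<star> [:b:]) n = coeff p n * b"
proof -
  show "degree (p \<star> [:b:]) \<le> n"
    by (rule degree_le) (simp add: mult_eq_sum[OF assms] coeff_sum coeff_shift_funpow_const)
  have "coeff (p \<star> [:b:]) n = (\<Sum>k\<le>n. coeff p k * coeff ((shift ^^ k) [:b:]) n)"
    by (simp add: mult_eq_sum[OF assms] coeff_sum)
  also have "\<dots> = (\<Sum>k\<in>{n}. coeff p k * coeff ((shift ^^ k) [:b:]) n)"
    by (rule sum.mono_neutral_right) (auto simp: coeff_shift_funpow_const)
  finally show "coeff (p \<star> [:b:]) n = coeff p n * b"
    by (simp add: coeff_shift_funpow_const)
qed

lemma degree_scale_le: "degree (scale a p) \<le> degree p"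
  by (rule degree_le) (simp add: coeff_eq_0)

lemma shift_funpow_monom_constant:
  assumes "\<delta> b = 0"
  shows "(shift ^^ k) (monom b m) = monom b (m + k)"
  using assms by (induction k) (simp_all add: shift_monom)

lemma coeff_mult_const_constant:
  assumes "\<delta> b = 0"
  shows "coeff (p \<star> [:b:]) k = coeff p k * b"
proof (induction p rule: poly_monom_induct)
  case (monom a n)
  show ?case
    using shift_funpow_monom_constant[OF assms, of n 0]
    by (simp add: monom_mult monom_0)
qed (simp add: mult_add_left algebra_simps)

text \<open>Since \<open>\<delta> b = 0\<close>, powers of the indeterminate pass through
  \<open>b\<close> unchanged; \<open>pCons 0\<close> is right multiplication by the
  indeterminate.\<close>

lemma mult_monom_Suc_0_constant:
  assumes "\<delta> b = 0"
  shows "p \<star> monom b (Suc 0) = pCons 0 (p \<star> [:b:])"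
proof (induction p rule: poly_monom_induct)
  case (monom a n)
  show ?case
    using shift_funpow_monom_constant[OF assms, of n 0]
      shift_funpow_monom_constant[OF assms, of n 1]
    by (simp add: monom_mult monom_0 scale_simps scale_pCons_zero monom_Suc)
next
  case (add p q)
  then show ?case by (simp add: mult_add_left)
qed

text \<open>The element \<open>ex\<close> stands in for \<open>x\<close> on the corner:
  \<open>(ex)h = e(hx + \<delta>(h)) = hx + \<delta>(h)\<close>, while
  \<open>h(ex) = (he)x = hx\<close>. Differentiating \<open>e c = c\<close> shows that
  \<open>e\<close> also fixes the coefficients of \<open>\<delta>(h)\<close>.\<close>

lemma commutator_monom_Suc_0:
  assumes e: "\<delta> e = 0" "[:e:] \<star> h = h" "h \<star> [:e:] = h"
  shows "monom e (Suc 0) \<star> h - h \<star> monom e (Suc 0) = map_poly \<delta> h"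
proof -
  have "e * coeff h k = coeff h k" for k
    using arg_cong[OF e(2), of "\<lambda>p. coeff p k"] by (simp add: const_mult)
  moreover from this have "e * \<delta> (coeff h k) = \<delta> (coeff h k)" for k
    using leibniz[of e "coeff h k"] e(1) by simp
  ultimately show ?thesis
    by (auto simp: monom_mult mult_monom_Suc_0_constant e poly_eq_iff shift_def coeff_pCons
        algebra_simps split: nat.splits)
qed

section \<open>Ideals invariant under the derivation\<close>

lemma group_closure_conj:
  assumes "derivation_simple \<delta>" "\<delta> ` P \<subseteq> P" "p \<in> P" "p \<noteq> 0" "p = r * p * s"
  shows "group_closure {r * p * s |r p s. p \<in> P} = UNIV" (is "?G = _")
proof -
  have conj: "r * p * s \<in> ?G" if "p \<in> P" for r p s
    using that by (intro group_closure.base) blast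
  have "\<delta> x \<in> ?G \<and> x * y \<in> ?G \<and> y * x \<in> ?G" if "x \<in> ?G" for x y
    using that
  proof (induction x rule: group_closure.induct)
    case (base x)
    show ?case
    \<comment> \<open>The generators of a \<open>group_closure\<close> include 0 besides the given
      set.\<close>
    proof (cases "x = 0")
      case False
      then obtain r p s where x: "x = r * p * s" "p \<in> P" using base by auto
      \<comment> \<open>Each summand again has a middle factor in \<open>P\<close>, because
        \<open>P\<close> is invariant under \<open>\<delta>\<close>.\<close>
      have "\<delta> x = r * p * \<delta> s + (r * \<delta> p * s + \<delta> r * p * s)"
        by (simp add: x leibniz algebra_simps)
      moreover have "\<delta> p \<in> P" using x assms(2) by auto
      ultimately have "\<delta> x \<in> ?G"
        using x(2) conj by (auto intro!: group_closure_add)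
      moreover have "x * y = r * p * (s * y)" "y * x = (y * r) * p * s"
        by (simp_all add: x mult.assoc)
      ultimately show ?thesis
        using conj x(2) by simp
    qed simp
  next
    case (diff x z)
    then show ?case by (auto simp: deriv_diff algebra_simps intro: group_closure.diff)
  qed
  then have "two_sided_ideal ?G type_ring" "\<delta> ` ?G \<subseteq> ?G"
    by (auto simp: two_sided_ideal_type_ring_iff intro: group_closure.diff)
  \<comment> \<open>In place of an identity element, the hypothesis \<open>p = r * p * s\<close>
    shows that the ideal is nonzero.\<close>
  moreover have "p \<in> ?G" using conj[OF assms(3), of r s] assms(5) by simp
  ultimately show ?thesis using assms(1,4) unfolding derivation_simple_def by blast
qed

text \<open>An invariant ideal \<open>J\<close> of \<open>R\<close> yields the ideal
  \<open>J[x]\<close> of \<open>S\<close>, from which \<open>J\<close> is recovered as the set of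
  constants.\<close>

lemma derivation_simple_if_simple:
  assumes "simple_ring (diff_poly_ring \<delta>)"
  shows "derivation_simple \<delta>"
  unfolding derivation_simple_def
proof (intro allI impI)
  fix J assume J: "two_sided_ideal J type_ring \<and> \<delta> ` J \<subseteq> J"
  then have J0: "0 \<in> J" and Jd: "\<And>x y. x \<in> J \<Longrightarrow> y \<in> J \<Longrightarrow> x - y \<in> J"
    and Jm: "\<And>a x. a \<in> J \<Longrightarrow> x * a \<in> J" "\<And>a x. a \<in> J \<Longrightarrow> a * x \<in> J"
    and J\<delta>: "\<And>a. a \<in> J \<Longrightarrow> \<delta> a \<in> J"
    by (auto simp: two_sided_ideal_type_ring_iff)
  have Ja: "x + y \<in> J" if "x \<in> J" "y \<in> J" for x y
    using Jd[OF that(1) Jd[OF J0 that(2)]] by simp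
  let ?K = "{p. \<forall>k. coeff p k \<in> J}"
  \<comment> \<open>The first alternative serves products with the element of \<open>?K\<close> on
    the right, the second those with it on the left.\<close>
  have K_scale: "scale a p \<in> ?K" if "p \<in> ?K \<or> a \<in> J" for a p
    using that Jm by auto
  have K_shift: "(shift ^^ n) p \<in> ?K" if "p \<in> ?K" for n p
    using that
    by (induction n) (auto simp: shift_def coeff_pCons J\<delta> J0 Ja split: nat.splits)
  have K_sum: "sum f {..n::nat} \<in> ?K" if "\<And>k. k \<le> n \<Longrightarrow> f k \<in> ?K" for f n
    using that by (induction n) (auto simp: Ja)
  have "two_sided_ideal ?K (diff_poly_ring \<delta>)"
    unfolding two_sided_ideal_diff_poly_ring_iff
  proof (intro conjI ballI allI)
    fix p q assume p: "p \<in> ?K"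
    show "q \<star> p \<in> ?K"
      unfolding mult_eq_sum[OF order_refl] by (intro K_sum K_scale disjI1 K_shift p)
    show "p \<star> q \<in> ?K"
      unfolding mult_eq_sum[OF order_refl] using p by (intro K_sum K_scale disjI2) auto
  qed (auto simp: J0 Jd)
  then have "?K = {0} \<or> ?K = UNIV"
    using assms by (auto simp: simple_ring_def diff_poly_ring_def)
  then show "J = {0} \<or> J = UNIV"
  proof
    assume "?K = {0}"
    then have "[:a:] = 0" if "a \<in> J" for a
      using that J0 by (auto simp: set_eq_iff coeff_pCons split: nat.splits dest!: spec[of _ "[:a:]"])
    then show ?thesis using J0 by auto
  next
    assume "?K = UNIV"
    then have "coeff [:a:] 0 \<in> J" for a by blast
    then show ?thesis by auto
  qed
qed

section \<open>Corners of the differential polynomial ring\<close>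

lemma carrier_corner:
  assumes "e * e = e"
  shows "carrier (corner (diff_poly_ring \<delta>) [:e:]) = {s. [:e:] \<star> s = s \<and> s \<star> [:e:] = s}"
proof -
  have "[:e:] \<star> [:e:] = [:e:]" by (rule const_idempotent) (rule assms)
  then have "[:e:] \<star> ([:e:] \<star> s \<star> [:e:]) = [:e:] \<star> s \<star> [:e:]"
    "([:e:] \<star> s \<star> [:e:]) \<star> [:e:] = [:e:] \<star> s \<star> [:e:]" for s
    by (metis mult_assoc)+
  then show ?thesis by (auto simp: corner_def diff_poly_ring_def) metis
qed

lemma corner_sel [simp]:
  "zero (corner (diff_poly_ring \<delta>) [:e:]) = 0"
  "add (corner (diff_poly_ring \<delta>) [:e:]) = (+)"
  "monoid.mult (corner (diff_poly_ring \<delta>) [:e:]) = (\<star>)"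
  "one (corner (diff_poly_ring \<delta>) [:e:]) = [:e:]"
  by (auto simp: corner_def diff_poly_ring_def)

lemma mult_minus_left: "(- p) \<star> q = - (p \<star> q)" and mult_minus_right: "p \<star> (- q) = - (p \<star> q)"
  using mult_diff_left[of 0 p q] mult_diff_right[of p 0 q] by auto

lemma ring_corner:
  assumes "e * e = e"
  shows "ring (corner (diff_poly_ring \<delta>) [:e:])"
proof (rule ringI)
  show "abelian_group (corner (diff_poly_ring \<delta>) [:e:])"
  proof (rule abelian_groupI)
    fix x assume "x \<in> carrier (corner (diff_poly_ring \<delta>) [:e:])"
    then show "\<exists>y\<in>carrier (corner (diff_poly_ring \<delta>) [:e:]).
        y \<oplus>\<^bsub>corner (diff_poly_ring \<delta>) [:e:]\<^esub> x = \<zero>\<^bsub>corner (diff_poly_ring \<delta>) [:e:]\<^esub>"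
      by (intro bexI[of _ "- x"])
        (auto simp: carrier_corner assms mult_minus_left mult_minus_right)
  qed (auto simp: carrier_corner assms mult_add_left mult_add_right algebra_simps)
  have "[:e:] \<star> [:e:] = [:e:]" by (rule const_idempotent) (rule assms)
  then show "monoid (corner (diff_poly_ring \<delta>) [:e:])"
    by (intro monoidI) (auto simp: carrier_corner assms mult_assoc, metis mult_assoc)
qed (auto simp: mult_add_left mult_add_right)

lemma two_sided_ideal_corner_iff:
  assumes "e * e = e"
  defines "C \<equiv> carrier (corner (diff_poly_ring \<delta>) [:e:])"
  shows "two_sided_ideal J (corner (diff_poly_ring \<delta>) [:e:]) \<longleftrightarrow>
    J \<subseteq> C \<and> 0 \<in> J \<and> (\<forall>x\<in>J. \<forall>y\<in>J. x - y \<in> J) \<and>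
    (\<forall>a\<in>J. \<forall>x\<in>C. x \<star> a \<in> J \<and> a \<star> x \<in> J)"
  unfolding two_sided_ideal_def C_def
  by (subst additive_subgroup_iff_diff_closed)
    (auto simp: carrier_corner assms(1) mult_minus_left mult_minus_right)

text \<open>The ideal \<open>SJS\<close> generated by a nonzero ideal \<open>J\<close> of the corner
  is all of \<open>S\<close>, and compressing it by \<open>e\<close> on both sides lands in
  \<open>J\<close>.\<close>

lemma simple_corner_if_simple:
  assumes simple: "simple_ring (diff_poly_ring \<delta>)" and e: "e \<noteq> 0" "e * e = e"
  shows "simple_ring (corner (diff_poly_ring \<delta>) [:e:])"
proof -
  let ?C = "carrier (corner (diff_poly_ring \<delta>) [:e:])"
  have E: "[:e:] \<star> [:e:] = [:e:]" by (rule const_idempotent) (rule e(2))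
  have "?C \<subseteq> J" if J: "two_sided_ideal J (corner (diff_poly_ring \<delta>) [:e:])" and "J \<noteq> {0}" for J
  proof -
    have JC: "J \<subseteq> ?C" and J0: "0 \<in> J" and Jd: "\<And>x y. x \<in> J \<Longrightarrow> y \<in> J \<Longrightarrow> x - y \<in> J"
      and Jm: "\<And>a x. a \<in> J \<Longrightarrow> x \<in> ?C \<Longrightarrow> x \<star> a \<in> J" "\<And>a x. a \<in> J \<Longrightarrow> x \<in> ?C \<Longrightarrow> a \<star> x \<in> J"
      using J by (auto simp: two_sided_ideal_corner_iff e)
    have Je: "[:e:] \<star> j = j" "j \<star> [:e:] = j" if "j \<in> J" for j
      using JC that by (auto simp: carrier_corner e)
    let ?K = "group_closure {p \<star> j \<star> q |p j q. j \<in> J}"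
    have conj: "p \<star> j \<star> q \<in> ?K" if "j \<in> J" for p j q
      using that by (intro group_closure.base) blast
    have "x \<star> y \<in> ?K \<and> y \<star> x \<in> ?K" if "x \<in> ?K" for x y
      using that
    proof (induction x rule: group_closure.induct)
      case (base x)
      show ?case
      proof (cases "x = 0")
        case False
        then obtain p j q where x: "x = p \<star> j \<star> q" "j \<in> J" using base by auto
        have "x \<star> y = p \<star> j \<star> (q \<star> y)" "y \<star> x = (y \<star> p) \<star> j \<star> q"
          by (simp_all add: x mult_assoc)
        then show ?thesis using conj x(2) by simp
      qed simp
    next
      case (diff x z)
      then show ?case by (auto simp: mult_diff_left mult_diff_right intro: group_closure.diff)
    qed
    then have "two_sided_ideal ?K (diff_poly_ring \<delta>)"
      by (auto simp: two_sided_ideal_diff_poly_ring_iff intro: group_closure.diff)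
    \<comment> \<open>Elements of \<open>J\<close> are themselves generators, as
      \<open>j = eje\<close>.\<close>
    moreover have "?K \<noteq> {0}"
    proof -
      obtain j where "j \<in> J" "j \<noteq> 0" using \<open>J \<noteq> {0}\<close> J0 by blast
      then show ?thesis using conj[of j "[:e:]" "[:e:]"] Je[of j] by auto
    qed
    ultimately have K: "?K = UNIV"
      using simple by (auto simp: simple_ring_def diff_poly_ring_def)
    have "[:e:] \<star> s \<star> [:e:] \<in> J" if "s \<in> ?K" for s
      using that
    proof (induction s rule: group_closure.induct)
      case (base s)
      show ?case
      proof (cases "s = 0")
        case False
        then obtain p j q where s: "s = p \<star> j \<star> q" "j \<in> J" using base by auto
        have "[:e:] \<star> t \<star> [:e:] \<in> ?C" for t
          by (auto simp: corner_def diff_poly_ring_def)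
        \<comment> \<open>Because \<open>j = eje\<close>, the compressed generator
          \<open>e(pjq)e\<close> equals \<open>(epe) j (eqe)\<close>, whose outer factors lie in the
          corner.\<close>
        then have "([:e:] \<star> p \<star> [:e:]) \<star> j \<star> ([:e:] \<star> q \<star> [:e:]) \<in> J"
          using s(2) Jm by blast
        moreover have "([:e:] \<star> p \<star> [:e:]) \<star> j \<star> ([:e:] \<star> q \<star> [:e:])
            = [:e:] \<star> p \<star> (([:e:] \<star> j) \<star> [:e:]) \<star> q \<star> [:e:]"
          by (simp add: mult_assoc)
        moreover have "\<dots> = [:e:] \<star> s \<star> [:e:]"
          using Je[OF s(2)] by (simp add: s mult_assoc)
        ultimately show ?thesis by simp
      qed (simp add: J0)
    next
      case (diff s t)
      then show ?case by (simp add: mult_diff_left mult_diff_right Jd)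
    qed
    then show "?C \<subseteq> J" using K by (auto simp: corner_def diff_poly_ring_def)
  qed
  moreover have "J \<subseteq> ?C" if "two_sided_ideal J (corner (diff_poly_ring \<delta>) [:e:])" for J
    using that by (simp add: two_sided_ideal_corner_iff e)
  moreover have "[:e:] \<in> ?C" "[:e:] \<noteq> 0" using E e by (auto simp: carrier_corner)
  ultimately show ?thesis
    unfolding simple_ring_def by (metis corner_sel(1) singletonD subset_antisym)
qed

section \<open>From the center of one corner back to the whole ring\<close>

lemma simple_if_field_center_corner:
  assumes s_unital: "s_unital TYPE('a)" and \<delta>_simple: "derivation_simple \<delta>"
    and e: "e \<noteq> 0" "e * e = e" "\<delta> e = 0"
    and field: "field (center (corner (diff_poly_ring \<delta>) [:e:]))"
  shows "simple_ring (diff_poly_ring \<delta>)"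
proof -
  define E where "E = [:e:]"
  define y where "y = monom e (Suc 0)"
  have E: "E \<star> E = E"
    unfolding E_def by (rule const_idempotent) (rule e(2))
  \<comment> \<open>The equality \<open>R = ReR\<close> as an induction principle. The set
    \<open>{0, e}\<close> is invariant because \<open>\<delta> e = 0\<close>.\<close>
  have ReR: "Q r" if "Q 0" "\<And>a b. Q a \<Longrightarrow> Q b \<Longrightarrow> Q (a - b)" "\<And>r s. Q (r * e * s)" for Q r
  proof -
    have "e = e * e * e" using e by simp
    then have "r \<in> group_closure {r * p * s |r p s. p \<in> {0, e}}"
      using group_closure_conj[OF \<delta>_simple, of "{0, e}" e e e] e by auto
    then show ?thesis
      by (induction r rule: group_closure.induct) (use that in auto)
  qed
  have "I = UNIV" if I: "two_sided_ideal I (diff_poly_ring \<delta>)" and "I \<noteq> {0}" for I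
  proof -
    have I0: "0 \<in> I" and Id: "\<And>x y. x \<in> I \<Longrightarrow> y \<in> I \<Longrightarrow> x - y \<in> I"
      and Im: "\<And>a x. a \<in> I \<Longrightarrow> x \<star> a \<in> I" "\<And>a x. a \<in> I \<Longrightarrow> a \<star> x \<in> I"
      using I by (auto simp: two_sided_ideal_diff_poly_ring_iff)
    have Ia: "x + y \<in> I" if "x \<in> I" "y \<in> I" for x y
      using Id[OF that(1) Id[OF I0 that(2)]] by simp
    define n where "n = (LEAST n. \<exists>f\<in>I. f \<noteq> 0 \<and> degree f = n)"
    have "\<exists>n. \<exists>f\<in>I. f \<noteq> 0 \<and> degree f = n" using I0 \<open>I \<noteq> {0}\<close> by blast
    from LeastI_ex[OF this] obtain f where f: "f \<in> I" "f \<noteq> 0" "degree f = n"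
      unfolding n_def by blast
    \<comment> \<open>Stating this through the coefficient at \<open>n\<close> includes the case
      \<open>n = 0\<close>.\<close>
    have minimal: "g = 0" if "g \<in> I" "degree g \<le> n" "coeff g n = 0" for g
    proof (rule ccontr)
      assume "g \<noteq> 0"
      with that have "n \<le> degree g" unfolding n_def by (intro Least_le) blast
      with that \<open>g \<noteq> 0\<close> show False by (metis leading_coeff_0_iff order_antisym)
    qed
    \<comment> \<open>Allowing degree below \<open>n\<close> adds only 0 and makes \<open>L\<close>
      closed under differences.\<close>
    define L where "L = {coeff g n |g. g \<in> I \<and> degree g \<le> n}"
    have L_I: "coeff g n \<in> L" if "g \<in> I" "degree g \<le> n" for g
      using that by (auto simp: L_def)
    have L0: "0 \<in> L" using L_I[OF I0] by simp
    have Ld: "a - b \<in> L" if "a \<in> L" "b \<in> L" for a b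
      using that Id unfolding L_def
      by clarify (metis coeff_diff degree_diff_le)
    have Lm: "r * a \<in> L" "a * r \<in> L" if "a \<in> L" for a r
    proof -
      obtain g where g: "g \<in> I" "degree g \<le> n" "a = coeff g n" using \<open>a \<in> L\<close> by (auto simp: L_def)
      show "r * a \<in> L"
        using L_I[OF Im(1)[OF g(1), of "[:r:]"]] g degree_scale_le[of r g] by (simp add: const_mult)
      show "a * r \<in> L"
        using L_I[OF Im(2)[OF g(1), of "[:r:]"]] mult_const_degree_le[OF g(2)] g by simp
    qed
    define a where "a = coeff f n"
    have a: "a \<in> L" "a \<noteq> 0" using L_I f by (auto simp: a_def)
    \<comment> \<open>Otherwise \<open>R = ReR\<close>, applied on the right and then on the left of
      \<open>a\<close>, gives \<open>RaR = 0\<close>; but \<open>a = uav\<close> for some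
      \<open>u\<close> and \<open>v\<close> by \<open>s\<close>-unitality.\<close>
    have "\<exists>r s. e * r * a * s * e \<noteq> 0"
    proof (rule ccontr)
      assume *: "\<not> ?thesis"
      have 1: "e * r * a * v = 0" for r v
      proof (rule ReR[of "\<lambda>v. e * r * a * v = 0"])
        show "e * r * a * (r' * e * s) = 0" for r' s
          using * by (simp flip: mult.assoc)
      qed (simp_all add: right_diff_distrib)
      have 2: "u * a * v = 0" for u v
      proof (rule ReR[of "\<lambda>u. u * a * v = 0"])
        show "r * e * s * a * v = 0" for r s
          using 1[of s v] by (simp add: mult.assoc)
      qed (simp_all add: left_diff_distrib)
      obtain u v where "a = u * a" "a = a * v" using s_unital unfolding s_unital_def by (metis IntE rangeE)
      then show False using 2 a by metis
    qed
    then obtain r s where rs: "e * (r * a * s) * e \<noteq> 0" by (auto simp: mult.assoc)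
    have corner_I: "E \<star> g \<star> E \<in> I" "degree (E \<star> g \<star> E) \<le> n" "coeff (E \<star> g \<star> E) n = e * coeff g n * e"
      "E \<star> (E \<star> g \<star> E) = E \<star> g \<star> E" "(E \<star> g \<star> E) \<star> E = E \<star> g \<star> E"
      if "g \<in> I" "degree g \<le> n" for g
    proof -
      have "degree (E \<star> g) \<le> n"
        using degree_scale_le[of e g] that by (simp add: E_def const_mult)
      then show "degree (E \<star> g \<star> E) \<le> n" "coeff (E \<star> g \<star> E) n = e * coeff g n * e"
        using mult_const_degree_le[of "E \<star> g" n e] by (auto simp: E_def const_mult)
      show "E \<star> g \<star> E \<in> I" using Im that by blast
      show "E \<star> (E \<star> g \<star> E) = E \<star> g \<star> E" "(E \<star> g \<star> E) \<star> E = E \<star> g \<star> E"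
        by (metis mult_assoc E)+
    qed
    \<comment> \<open>Coefficientwise derivatives of corner elements of \<open>I\<close> stay in
      \<open>I\<close>, being commutators with \<open>y\<close>.\<close>
    have deriv_I: "map_poly \<delta> h \<in> I" "degree (map_poly \<delta> h) \<le> n"
      "y \<star> h - h \<star> y = map_poly \<delta> h"
      if "h \<in> I" "degree h \<le> n" "E \<star> h = h" "h \<star> E = h" for h
    proof -
      show 1: "y \<star> h - h \<star> y = map_poly \<delta> h"
        using commutator_monom_Suc_0[OF e(3)] that by (simp add: y_def E_def)
      show "map_poly \<delta> h \<in> I" unfolding 1[symmetric] using that Im Id by blast
      show "degree (map_poly \<delta> h) \<le> n" using that(2) by (intro degree_le) (simp add: coeff_eq_0)
    qed
    let ?P = "{e * b * e |b. b \<in> L}"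
    have "\<delta> ` ?P \<subseteq> ?P"
    proof clarify
      fix b assume "b \<in> L"
      then obtain g where g: "g \<in> I" "degree g \<le> n" "b = coeff g n" by (auto simp: L_def)
      note h = corner_I[OF g(1,2)]
      \<comment> \<open>The witness for \<open>b'\<close> is \<open>\<delta> (e * b * e)\<close>
        itself, the coefficient at \<open>n\<close> of the derivative of \<open>ege\<close>.\<close>
      have "\<delta> (e * b * e) \<in> L"
        using L_I[OF deriv_I(1,2)] h g(3) by (metis coeff_map_deriv)
      moreover have "\<delta> (e * b * e) = e * \<delta> (e * b * e) * e"
        using e by (simp add: leibniz mult.assoc) (simp flip: mult.assoc)
      ultimately show "\<exists>b'. \<delta> (e * b * e) = e * b' * e \<and> b' \<in> L" by blast
    qed
    moreover have "e * (r * a * s) * e \<in> ?P" using a Lm by blast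
    \<comment> \<open>This supplies the condition \<open>p = r * p * s\<close> of
      \<open>group_closure_conj\<close>.\<close>
    moreover have "e * (r * a * s) * e = e * (e * (r * a * s) * e) * e"
      using e by (metis mult.assoc)
    ultimately have RPR: "group_closure {r * p * s |r p s. p \<in> ?P} = UNIV"
      using rs by (intro group_closure_conj[OF \<delta>_simple])
    have "x \<in> L" if "x \<in> group_closure {r * p * s |r p s. p \<in> ?P}" for x
      using that by (induction x rule: group_closure.induct) (auto simp: L0 Ld Lm)
    then have "e \<in> L" using RPR by blast
    then obtain g where g: "g \<in> I" "degree g \<le> n" "coeff g n = e" by (auto simp: L_def)
    define h where "h = E \<star> g \<star> E"
    note h = corner_I[OF g(1,2), folded h_def]
    have hn: "coeff h n = e" using h(3) g(3) e by simp
    have comm_const: "[:c:] \<star> h = h \<star> [:c:]" if c: "e * c = c" "c * e = c" for c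
    proof -
      have "[:c:] \<star> h - h \<star> [:c:] = 0"
      proof (rule minimal)
        show "[:c:] \<star> h - h \<star> [:c:] \<in> I" using h Im Id by blast
        show "degree ([:c:] \<star> h - h \<star> [:c:]) \<le> n"
          using degree_scale_le[of c h] mult_const_degree_le[OF h(2), of c] h(2)
          by (intro degree_diff_le) (auto simp: const_mult)
        \<comment> \<open>The coefficient is \<open>c * e - e * c\<close>, and \<open>e\<close>
          fixes \<open>c\<close> on both sides.\<close>
        show "coeff ([:c:] \<star> h - h \<star> [:c:]) n = 0"
          using mult_const_degree_le[OF h(2), of c] c hn by (simp add: const_mult)
      qed
      then show ?thesis by simp
    qed
    \<comment> \<open>The commutator has coefficient \<open>\<delta> e = 0\<close> at
      \<open>n\<close>, so minimality applies.\<close>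
    have comm_y: "y \<star> h = h \<star> y"
      using minimal[OF deriv_I(1,2)[OF h(1,2,4,5)]] deriv_I(3)[OF h(1,2,4,5)] hn e by simp
    have comm_monom: "monom c m \<star> h = h \<star> monom c m" if c: "e * c = c" "c * e = c" for c m
    proof (induction m)
      case 0
      show ?case using comm_const[OF c] by (simp add: monom_0)
    next
      case (Suc m)
      \<comment> \<open>With this, \<open>c x^(m+1)\<close> factors as \<open>(c x^m)(ex)\<close>,
        so commuting with \<open>y\<close> drives the induction.\<close>
      have "monom c m \<star> [:e:] = monom c m"
        using c by (auto simp: poly_eq_iff coeff_mult_const_constant e)
      then have "monom c (Suc m) = monom c m \<star> y"
        by (simp only: y_def mult_monom_Suc_0_constant[OF e(3)] monom_Suc[of c m])
      then show ?case using Suc comm_y by (metis mult_assoc)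
    qed
    have comm: "(E \<star> t \<star> E) \<star> h = h \<star> (E \<star> t \<star> E)" for t
    proof (induction t rule: poly_monom_induct)
      case (monom c m)
      have "E \<star> monom c m \<star> E = monom (e * c * e) m"
        by (auto simp: poly_eq_iff E_def coeff_mult_const_constant e const_mult)
      then show ?case
        using comm_monom[of "e * c * e" m] e by (metis mult.assoc)
    qed (simp add: mult_add_left mult_add_right)
    let ?Z = "center (corner (diff_poly_ring \<delta>) [:e:])"
    have "h \<in> carrier ?Z"
      using h comm by (auto simp: center_def carrier_corner e E_def) metis
    moreover have "h \<noteq> \<zero>\<^bsub>?Z\<^esub>" using hn e by (auto simp: center_def)
    ultimately have "h \<in> Units ?Z" using field.field_Units[OF field] by blast
    then obtain k where "h \<star> k = E" by (auto simp: Units_def center_def E_def)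
    then have "E \<in> I" using h Im by metis
    \<comment> \<open>Coefficients reduce to the form \<open>r * e * s\<close>, where
      \<open>E \<in> I\<close> becomes a factor of the monomial.\<close>
    have "monom r m \<in> I" for r m
    proof (rule ReR[of "\<lambda>r. monom r m \<in> I"])
      show "monom (r * e * s) m \<in> I" for r s
      proof -
        have "monom (r * e * s) m = [:r:] \<star> (E \<star> monom s m)"
          by (simp add: E_def const_mult scale_simps mult.assoc)
        then show ?thesis using Im \<open>E \<in> I\<close> by metis
      qed
    qed (use I0 Id in \<open>auto simp flip: diff_monom\<close>)
    then have "t \<in> I" for t by (induction t rule: poly_monom_induct) (auto intro: Ia)
    then show ?thesis by blast
  qed
  moreover have "(UNIV :: 'a poly set) \<noteq> {0}"
    using e by (metis UNIV_I pCons_eq_0_iff singletonD)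
  ultimately show ?thesis by (auto simp: simple_ring_def diff_poly_ring_def)
qed

end

theorem theorem15:
  fixes \<delta> :: "'a::ring \<Rightarrow> 'a"
  assumes "s_unital TYPE('a)"
    and "derivation \<delta>"
    and "\<exists>e. e \<noteq> 0 \<and> e * e = e \<and> \<delta> e = 0"
  shows
    "(simple_ring (diff_poly_ring \<delta>) \<longleftrightarrow>
        derivation_simple \<delta> \<and>
        (\<forall>e. e \<noteq> 0 \<and> e * e = e \<longrightarrow> simple_ring (corner (diff_poly_ring \<delta>) [:e:]))) \<and>
     (simple_ring (diff_poly_ring \<delta>) \<longleftrightarrow>
        derivation_simple \<delta> \<and>
        (\<forall>e. e \<noteq> 0 \<and> e * e = e \<longrightarrow> field (center (corner (diff_poly_ring \<delta>) [:e:])))) \<and>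
     (simple_ring (diff_poly_ring \<delta>) \<longleftrightarrow>
        derivation_simple \<delta> \<and>
        (\<exists>e. e \<noteq> 0 \<and> e * e = e \<and> \<delta> e = 0 \<and>
             simple_ring (corner (diff_poly_ring \<delta>) [:e:]))) \<and>
     (simple_ring (diff_poly_ring \<delta>) \<longleftrightarrow>
        derivation_simple \<delta> \<and>
        (\<exists>e. e \<noteq> 0 \<and> e * e = e \<and> \<delta> e = 0 \<and>
             field (center (corner (diff_poly_ring \<delta>) [:e:]))))"
proof -
  interpret derivation_ring \<delta> by unfold_locales (rule assms)
  have "field (center (corner (diff_poly_ring \<delta>) [:e:]))"
    if "e * e = e" "simple_ring (corner (diff_poly_ring \<delta>) [:e:])" for e
    using ring.field_center_if_simple[OF ring_corner] that by blast
  \<comment> \<open>Universal clauses specialise to existential ones at the idempotent of the third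
    assumption. A simple corner has a field as its center, and such a center for one
    \<open>e\<close> with \<open>\<delta> e = 0\<close> returns simplicity of
    \<open>S\<close>.\<close>
  then show ?thesis
    using assms(1,3) derivation_simple_if_simple simple_corner_if_simple
      simple_if_field_center_corner by metis
qed

end
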